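(* Let $\mathbb P$ be a lattice with greatest element $1$. If condition $\mathsf C_{\omega,1}$ holds, then $\mathsf S_1(\mathsf V_1,\mathsf V_1)$ holds if and only if Player I has no winning strategy in the game $\mathsf G_1(\mathsf V_1,\mathsf V_1)$.
   Context: For a lattice $\mathbb P$ with greatest element $1$, $\mathsf V_1$ denotes the family of all nonempty subsets of $\mathbb P$ whose supremum is $1$. Condition $\mathsf C_{\omega,1}$: for every countable $A\in\mathsf V_1$ and every $x\in\mathbb P$, the supremum $\bigvee_{a\in A}(x\wedge a)$ exists and equals $x$. For a nonempty family $\mathcal B$ of nonempty subsets of a set $D$: $\mathsf S_1(\mathcal B,\mathcal B)$ asserts that for every sequence $(A_n)_{n\in\omega}$ in $\mathcal B$ there are $a_n\in A_n$ with $\{a_n:n\in\omega\}\in\mathcal B$. In the game $\mathsf G_1(\mathcal B,\mathcal B)$, in each inning $n\in\omega$ Player I chooses $A_n\in\mathcal B$ and then Player II chooses $a_n\in A_n$; Player II wins if $\{a_n:n\in\omega\}\in\mathcal B$, otherwise Player I wins. A strategy is a function telling a player how to play based on the previous moves of the opponent. *)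

theory Defs
  imports Main "HOL-Library.Countable_Set" "HOL-Library.Lub_Glb"
begin

text \<open>
  The lattice is a type of class \<^class>\<open>bounded_lattice_top\<close>; it need not be complete, so suprema
  are expressed through the relation \<^const>\<open>isLub\<close>, taken relative to the whole type.
\<close>

definition V1 :: "'a::bounded_lattice_top set set" where
  "V1 = {A. A \<noteq> {} \<and> isLub UNIV A top}"

text \<open>``Countable'' includes finite.\<close>

definition C_omega_1 :: "'a::bounded_lattice_top itself \<Rightarrow> bool" where
  "C_omega_1 _ \<longleftrightarrow>
    (\<forall>A \<in> (V1 :: 'a set set). countable A \<longrightarrow> (\<forall>x. isLub UNIV ((\<lambda>a. inf x a) ` A) x))"

definition S1 :: "'d set set \<Rightarrow> 'd set set \<Rightarrow> bool" where
  "S1 \<A> \<B> \<longleftrightarrow>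
    (\<forall>A :: nat \<Rightarrow> 'd set. (\<forall>n. A n \<in> \<A>) \<longrightarrow> (\<exists>a. (\<forall>n. a n \<in> A n) \<and> range a \<in> \<B>))"

text \<open>
  In \<open>G1 \<A> \<B>\<close>, a play is a pair of sequences \<open>A\<close> (the moves of Player I) and \<open>a\<close> (the moves of
  Player II). A strategy for Player I maps the finite list of Player II's previous moves, in
  chronological order, to the next move of Player I.
\<close>

definition G1_play :: "'d set set \<Rightarrow> (nat \<Rightarrow> 'd set) \<Rightarrow> (nat \<Rightarrow> 'd) \<Rightarrow> bool" where
  "G1_play \<A> A a \<longleftrightarrow> (\<forall>n. A n \<in> \<A> \<and> a n \<in> A n)"

definition G1_II_wins :: "'d set set \<Rightarrow> (nat \<Rightarrow> 'd) \<Rightarrow> bool" where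
  "G1_II_wins \<B> a \<longleftrightarrow> range a \<in> \<B>"

definition G1_I_strategy :: "'d set set \<Rightarrow> ('d list \<Rightarrow> 'd set) \<Rightarrow> bool" where
  "G1_I_strategy \<A> \<sigma> \<longleftrightarrow> (\<forall>h. \<sigma> h \<in> \<A>)"

definition G1_I_winning_strategy ::
    "'d set set \<Rightarrow> 'd set set \<Rightarrow> ('d list \<Rightarrow> 'd set) \<Rightarrow> bool" where
  "G1_I_winning_strategy \<A> \<B> \<sigma> \<longleftrightarrow>
    G1_I_strategy \<A> \<sigma> \<and>
    (\<forall>A a. G1_play \<A> A a \<and> (\<forall>n. A n = \<sigma> (map a [0..<n])) \<longrightarrow> \<not> G1_II_wins \<B> a)"

end

theory Submission
  imports Defs
begin

text \<open>
  If a sequence of covers (members of \<^const>\<open>V1\<close>) witnesses the failure of the selection principle,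
  Player I wins by playing that sequence, whatever Player II does. The converse is a lattice version
  of Pawlikowski's theorem on the Rothberger game. A trivial lattice is dealt with separately; in a
  nontrivial one the argument is as follows.

  Finite meets of covers are handled through \<^emph>\<open>join-dense\<close> sets, those for which every \<open>x\<close> is the
  supremum of the members below \<open>x\<close>. The hypothesis says that the downward closure of a countable
  cover is join-dense, and finite intersections of join-dense lower sets are join-dense.

  By the selection principle every cover has a countable subcover, so Player I may be assumed to
  play countable covers. Let Player II keep a finite set of histories instead of a single one.
  The finitely many covers that Player I would play in these histories have a countable common
  refinement, from which a finite set \<open>F\<^sub>n\<close> is chosen; every \<open>u \<in> F\<^sub>n\<close> prolongs every
  history \<open>h\<close> by a legal move lying above \<open>u\<close>. Two lemmas finish the proof. Lemma \<open>finite_choices\<close>,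
  the analogue of Hurewicz's theorem on the Menger game, says that the finite sets can be chosen
  so that \<open>\<Union>n\<ge>i. F\<^sub>n\<close> is a cover for every \<open>i\<close>. Lemma \<open>one_from_each\<close> then selects one
  \<open>u\<^sub>n \<in> F\<^sub>n\<close> for each \<open>n\<close> so that the \<open>u\<^sub>n\<close> form a cover. Following the \<open>u\<^sub>n\<close>, one obtains a
  single play against the strategy in which the \<open>n\<close>-th move of Player II lies above \<open>u\<^sub>n\<close>.
\<close>

section \<open>Covers and join-dense sets\<close>

lemma V1_iff:
  "A \<in> V1 \<longleftrightarrow> A \<noteq> {} \<and> (\<forall>b. (\<forall>a\<in>A. a \<le> b) \<longrightarrow> b = (top::'a::bounded_lattice_top))"
  by (auto simp: V1_def isLub_def leastP_def isUb_def setle_def setge_def top_unique)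

lemma C_omega_1_le:
  assumes "C_omega_1 TYPE('a::bounded_lattice_top)" "(A::'a set) \<in> V1" "countable A"
    and "\<And>a. a \<in> A \<Longrightarrow> inf x a \<le> b"
  shows "x \<le> b"
proof -
  have "isLub UNIV ((\<lambda>a. inf x a) ` A) x"
    using assms(1-3) unfolding C_omega_1_def by blast
  then show ?thesis
    using assms(4) by (auto simp: isLub_def leastP_def isUb_def setle_def setge_def)
qed

text \<open>
  Every element is the supremum of the members of \<open>Y\<close> below it; since it is obviously an upper
  bound of these, only minimality is required.
\<close>

definition join_dense :: "'a::order set \<Rightarrow> bool" where
  "join_dense Y \<longleftrightarrow> (\<forall>x b. (\<forall>y\<in>Y. y \<le> x \<longrightarrow> y \<le> b) \<longrightarrow> x \<le> b)"

text \<open>The downward closed sets.\<close>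

definition lower_set :: "'a::order set \<Rightarrow> bool" where
  "lower_set Y \<longleftrightarrow> (\<forall>y\<in>Y. \<forall>z\<le>y. z \<in> Y)"

lemma join_denseI:
  "(\<And>x b. (\<And>y. y \<in> Y \<Longrightarrow> y \<le> x \<Longrightarrow> y \<le> b) \<Longrightarrow> x \<le> b) \<Longrightarrow> join_dense Y"
  unfolding join_dense_def by blast

lemma join_denseD:
  "join_dense Y \<Longrightarrow> (\<And>y. y \<in> Y \<Longrightarrow> y \<le> x \<Longrightarrow> y \<le> b) \<Longrightarrow> x \<le> b"
  unfolding join_dense_def by blast

text \<open>In the one-element lattice the empty set is join-dense, hence the assumption on \<open>z\<close>.\<close>

lemma join_dense_imp_V1:
  assumes "join_dense (Y::'a set)" and "(z::'a::bounded_lattice_top) \<noteq> top"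
  shows "Y \<in> V1"
  unfolding V1_iff
proof (intro conjI allI impI)
  have "top \<le> z" if "Y = {}"
    by (rule join_denseD[OF assms(1)]) (use that in auto)
  then show "Y \<noteq> {}"
    using assms(2) by (auto simp: top_unique)
next
  fix b assume b: "\<forall>a\<in>Y. a \<le> b"
  have "top \<le> b"
    by (rule join_denseD[OF assms(1)]) (use b in auto)
  then show "b = top"
    by (simp add: top_unique)
qed

lemma join_dense_if_below_cover:
  assumes "C_omega_1 TYPE('a::bounded_lattice_top)" "(A::'a set) \<in> V1" "countable A"
    and "\<And>a y. a \<in> A \<Longrightarrow> y \<le> a \<Longrightarrow> y \<in> Y"
  shows "join_dense Y"
proof (rule join_denseI)
  fix x b assume *: "\<And>y. y \<in> Y \<Longrightarrow> y \<le> x \<Longrightarrow> y \<le> b"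
  show "x \<le> b"
  proof (rule C_omega_1_le[OF assms(1-3)])
    fix a assume "a \<in> A"
    then have "inf x a \<in> Y" using assms(4) by simp
    then show "inf x a \<le> b" using * by simp
  qed
qed

lemma join_dense_Int:
  assumes "join_dense A" "lower_set A" "join_dense B"
  shows "join_dense (A \<inter> B)"
proof (rule join_denseI)
  fix x b assume *: "\<And>y. y \<in> A \<inter> B \<Longrightarrow> y \<le> x \<Longrightarrow> y \<le> b"
  show "x \<le> b"
  proof (rule join_denseD[OF assms(1)])
    fix y assume y: "y \<in> A" "y \<le> x"
    show "y \<le> b"
    proof (rule join_denseD[OF assms(3)])
      fix z assume "z \<in> B" "z \<le> y"
      then show "z \<le> b"
        using * y assms(2) unfolding lower_set_def by (meson IntI order_trans)
    qed
  qed
qed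

lemma join_dense_INT:
  assumes "finite S" "\<And>s. s \<in> S \<Longrightarrow> join_dense (A s)" "\<And>s. s \<in> S \<Longrightarrow> lower_set (A s)"
  shows "join_dense (\<Inter>s\<in>S. A s)"
  using assms
proof (induction S)
  case empty
  then show ?case by (auto intro: join_denseI)
next
  case (insert s S)
  then show ?case by (simp add: join_dense_Int)
qed

text \<open>The Lindelof property, obtained by selecting from a constant sequence.\<close>

lemma countable_subcover:
  fixes A :: "'a::bounded_lattice_top set"
  assumes "S1 (V1 :: 'a set set) V1" "A \<in> V1"
  obtains e :: "nat \<Rightarrow> 'a" where "range e \<subseteq> A" "range e \<in> V1"
proof -
  obtain a :: "nat \<Rightarrow> 'a" where "\<forall>n. a n \<in> A" "range a \<in> V1"
    using assms(1)[unfolded S1_def, rule_format, of "\<lambda>_. A"] assms(2) by blast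
  then show ?thesis using that by blast
qed

section \<open>One element from each of infinitely many sets\<close>

lemma injective_choice:
  fixes M :: "nat \<Rightarrow> 'b set"
  assumes "\<And>n. finite (M n)" "\<And>n. card (M n) > n"
  obtains r where "inj r" "\<And>n. r n \<in> M n"
proof -
  have "\<exists>r. \<forall>n. r n \<in> M n \<and> r n \<notin> r ` {..<n}"
  proof (rule dependent_wellorder_choice)
    fix r and f g :: "nat \<Rightarrow> 'b" and n :: nat
    assume "\<And>k. k < n \<Longrightarrow> f k = g k"
    then have "f ` {..<n} = g ` {..<n}" by (intro image_cong) auto
    then show "(r \<in> M n \<and> r \<notin> f ` {..<n}) = (r \<in> M n \<and> r \<notin> g ` {..<n})" by simp
  next
    fix n :: nat and f :: "nat \<Rightarrow> 'b"
    have "card (f ` {..<n}) \<le> n"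
      using card_image_le[of "{..<n}" f] by simp
    then have "\<not> M n \<subseteq> f ` {..<n}"
      using assms(2)[of n] card_mono[of "f ` {..<n}" "M n"] by fastforce
    then show "\<exists>r. r \<in> M n \<and> r \<notin> f ` {..<n}" by blast
  qed
  then obtain r where r: "\<And>n. r n \<in> M n" "\<And>n. r n \<notin> r ` {..<n}" by blast
  have "inj r"
    by (rule linorder_injI) (metis r(2) imageI lessThan_iff)
  then show ?thesis using r(1) that by blast
qed

text \<open>
  The elements that lie below members of \<open>n\<close> different sets \<open>F m\<close> with \<open>m \<ge> k\<close>, that is, below
  an \<open>n\<close>-fold meet, form a join-dense set.
\<close>

lemma join_dense_below_meets:
  fixes F :: "nat \<Rightarrow> 'a::bounded_lattice_top set"
  assumes C: "C_omega_1 TYPE('a)"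
    and cnt: "\<And>n. countable (F n)" and tails: "\<And>k. (\<Union>n\<in>{k..}. F n) \<in> V1"
  shows "join_dense {y. \<exists>M. finite M \<and> card M = n \<and> M \<subseteq> {k..} \<and> (\<forall>m\<in>M. \<exists>u\<in>F m. y \<le> u)}"
    (is "join_dense (?P n k)")
proof (induction n arbitrary: k)
  case 0
  have "y \<in> ?P 0 k" for y
    by (rule CollectI, rule exI[of _ "{}"]) simp
  then have "?P 0 k = UNIV" by blast
  then show ?case by (auto intro: join_denseI)
next
  case (Suc n)
  show ?case
  proof (rule join_denseI)
    fix x b assume *: "\<And>y. y \<in> ?P (Suc n) k \<Longrightarrow> y \<le> x \<Longrightarrow> y \<le> b"
    show "x \<le> b"
    proof (rule C_omega_1_le[OF C tails])
      show "countable (\<Union>m\<in>{k..}. F m)" using cnt by blast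
      fix u assume "u \<in> (\<Union>m\<in>{k..}. F m)"
      then obtain m where m: "m \<ge> k" "u \<in> F m" by auto
      show "inf x u \<le> b"
      proof (rule join_denseD[OF Suc.IH[of "Suc m"]])
        fix y assume y: "y \<in> ?P n (Suc m)" "y \<le> inf x u"
        then obtain M where M: "finite M" "card M = n" "M \<subseteq> {Suc m..}"
          "\<forall>m\<in>M. \<exists>u\<in>F m. y \<le> u" by blast
        have "m \<notin> M" using M(3) by auto
        then have "finite (insert m M) \<and> card (insert m M) = Suc n \<and> insert m M \<subseteq> {k..} \<and>
            (\<forall>l\<in>insert m M. \<exists>u\<in>F l. y \<le> u)"
          using M m y(2) by fastforce
        then have "y \<in> ?P (Suc n) k" by (intro CollectI exI)
        then show "y \<le> b" using * y(2) by simp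
      qed
    qed
  qed
qed

text \<open>
  The selection principle is applied to the covers formed by the elements below \<open>(n+1)\<close>-fold meets.
  The \<open>n\<close>-th selected element \<open>p n\<close> lies below members of \<open>n + 1\<close> different sets \<open>F m\<close>, and it is
  replaced by a member of one of these that has not been used for a smaller index.
\<close>

lemma one_from_each:
  fixes F :: "nat \<Rightarrow> 'a::bounded_lattice_top set"
  assumes C: "C_omega_1 TYPE('a)" and S1: "S1 (V1 :: 'a set set) V1"
    and nontrivial: "(z::'a) \<noteq> top"
    and cnt: "\<And>n. countable (F n)" and ne: "\<And>n. F n \<noteq> {}"
    and tails: "\<And>k. (\<Union>n\<in>{k..}. F n) \<in> V1"
  obtains u where "\<And>n. u n \<in> F n" "range u \<in> V1"
proof -
  let ?P = "\<lambda>n. {y. \<exists>M. finite M \<and> card M = n \<and> M \<subseteq> {0::nat..} \<and> (\<forall>m\<in>M. \<exists>u\<in>F m. y \<le> u)}"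
  have "?P (Suc n) \<in> V1" for n
    using join_dense_imp_V1[OF join_dense_below_meets[OF C cnt tails] nontrivial] .
  then have "\<exists>p. (\<forall>n. p n \<in> ?P (Suc n)) \<and> range p \<in> V1"
    using S1[unfolded S1_def, rule_format, of "\<lambda>n. ?P (Suc n)"] by blast
  then obtain p where p: "\<And>n. p n \<in> ?P (Suc n)" "range p \<in> V1" by blast
  have "\<forall>n. \<exists>M. finite M \<and> card M = Suc n \<and> (\<forall>m\<in>M. \<exists>u\<in>F m. p n \<le> u)"
    using p(1) by blast
  then obtain M where M: "\<And>n. finite (M n)" "\<And>n. card (M n) = Suc n"
    "\<And>n m. m \<in> M n \<Longrightarrow> \<exists>u\<in>F m. p n \<le> u" by metis
  obtain r where r: "inj r" "\<And>n. r n \<in> M n"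
    using injective_choice[of M] M by auto
  have "\<exists>u\<in>F m. \<forall>n. r n = m \<longrightarrow> p n \<le> u" for m
  proof (cases "m \<in> range r")
    case True
    then obtain n where n: "m = r n" by blast
    then obtain u where "u \<in> F m" "p n \<le> u" using M(3) r(2) by blast
    then show ?thesis using n r(1) by (metis injD)
  next
    case False
    then show ?thesis using ne[of m] by blast
  qed
  then obtain u where u: "\<And>m. u m \<in> F m" "\<And>m n. r n = m \<Longrightarrow> p n \<le> u m" by metis
  have "range u \<in> V1"
    unfolding V1_iff
  proof (intro conjI allI impI)
    fix b assume b: "\<forall>a\<in>range u. a \<le> b"
    have "p n \<le> b" for n
      using u(2)[OF refl, of n] b by (blast intro: order_trans)
    then show "b = top" using p(2) unfolding V1_iff by blast
  qed simp
  then show ?thesis using u(1) that by blast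
qed

section \<open>Finite choices along a tree of countable covers\<close>

text \<open>
  Think of a finite sequence \<open>s\<close> of numbers as choices of the sets \<open>F (take j s) (s ! j)\<close> for
  \<open>j < length s\<close>. The set below consists of the elements that are below every upper bound of those
  chosen sets for which \<open>s ! j \<ge> i\<close>. The threshold \<open>i\<close> serves to ignore an initial segment of an
  infinite sequence of choices, as a large \<open>i\<close> excludes the choices made there. Working with
  upper bounds instead of joins makes sense also if no choice counts, although a
  least element need not exist.
\<close>

definition covered :: "(nat list \<Rightarrow> nat \<Rightarrow> 'a::order set) \<Rightarrow> nat \<Rightarrow> nat list \<Rightarrow> 'a set" where
  "covered F i s =
    {y. \<forall>b. (\<forall>j<length s. i \<le> s ! j \<longrightarrow> (\<forall>u\<in>F (take j s) (s ! j). u \<le> b)) \<longrightarrow> y \<le> b}"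

lemma covered_downward: "y \<in> covered F i s \<Longrightarrow> z \<le> y \<Longrightarrow> z \<in> covered F i s"
  unfolding covered_def by (auto intro: order_trans)

lemma covered_snoc:
  "y \<in> covered F i (s @ [m]) \<longleftrightarrow>
    (\<forall>b. (\<forall>j<length s. i \<le> s ! j \<longrightarrow> (\<forall>u\<in>F (take j s) (s ! j). u \<le> b)) \<and>
         (i \<le> m \<longrightarrow> (\<forall>u\<in>F s m. u \<le> b)) \<longrightarrow> y \<le> b)"
proof -
  have "(\<forall>j<length (s @ [m]). i \<le> (s @ [m]) ! j \<longrightarrow>
          (\<forall>u\<in>F (take j (s @ [m])) ((s @ [m]) ! j). u \<le> b)) \<longleftrightarrow>
        (\<forall>j<length s. i \<le> s ! j \<longrightarrow> (\<forall>u\<in>F (take j s) (s ! j). u \<le> b)) \<and>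
        (i \<le> m \<longrightarrow> (\<forall>u\<in>F s m. u \<le> b))" for b
    by (auto simp: nth_append less_Suc_eq)
  then show ?thesis by (simp only: covered_def mem_Collect_eq)
qed

lemma covered_extend: "y \<in> covered F i s \<Longrightarrow> y \<in> covered F i (s @ [m])"
  unfolding covered_snoc by (simp add: covered_def)

lemma covered_mono:
  assumes "\<And>s. mono (F s)" "m \<le> m'" "y \<in> covered F i (s @ [m])"
  shows "y \<in> covered F i (s @ [m'])"
proof -
  have "F s m \<subseteq> F s m'" using assms(1,2) by (simp add: monoD)
  then show ?thesis
    using assms(2,3) unfolding covered_snoc by (meson order_trans subsetD)
qed

text \<open>
  An element covered by all short sequences that end with \<open>k\<close> is covered by a sequence, one step
  longer, as soon as that sequence has an entry greater than \<open>k\<close>. This leaves finitely many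
  sequences to be considered.
\<close>

lemma covered_large_entry:
  assumes mono: "\<And>s. mono (F s)"
    and y: "\<And>s. length s < n \<Longrightarrow> y \<in> covered F i (s @ [k])"
  shows "length s \<le> n \<Longrightarrow> \<not> set s \<subseteq> {..k} \<Longrightarrow> y \<in> covered F i s"
proof (induction s rule: rev_induct)
  case (snoc x s)
  show ?case
  proof (cases "set s \<subseteq> {..k}")
    case True
    then have "k \<le> x" using snoc.prems by auto
    then show ?thesis using covered_mono[OF mono] y[of s] snoc.prems(1) by simp
  next
    case False
    then show ?thesis using snoc by (simp add: covered_extend)
  qed
qed simp

text \<open>
  Consider the elements for which some last entry \<open>m\<close> ensures that they are covered by all
  sequences of length at most \<open>n\<close> that end with \<open>m\<close>. They form a join-dense set.
\<close>

lemma join_dense_covered: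
  fixes F :: "nat list \<Rightarrow> nat \<Rightarrow> 'a::bounded_lattice_top set"
  assumes C: "C_omega_1 TYPE('a)"
    and mono: "\<And>s. mono (F s)" and cnt: "\<And>s m. countable (F s m)"
    and cover: "\<And>s. (\<Union>m. F s m) \<in> V1"
  shows "join_dense {y. \<exists>m. \<forall>s. length s < n \<longrightarrow> y \<in> covered F i (s @ [m])}"
    (is "join_dense (?D n)")
proof (induction n)
  case 0
  then show ?case by (auto intro: join_denseI)
next
  case (Suc n)
  have dense1: "join_dense (\<Union>m. covered F i (s @ [m]))" for s
  proof (rule join_dense_if_below_cover[OF C cover])
    show "countable (\<Union>m. F s m)" using cnt by blast
    fix u y assume "u \<in> (\<Union>m. F s m)" "y \<le> u"
    then obtain m where m: "u \<in> F s m" by blast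
    then have "u \<in> F s (max i m)" using monoD[OF mono, of m "max i m" s] by auto
    then have "u \<in> covered F i (s @ [max i m])" by (auto simp: covered_snoc)
    then show "y \<in> (\<Union>m. covered F i (s @ [m]))"
      using covered_downward[OF _ \<open>y \<le> u\<close>] by blast
  qed
  have lower1: "lower_set (\<Union>m. covered F i (s @ [m]))" for s
    unfolding lower_set_def by (auto intro: covered_downward)
  show ?case
  proof (rule join_denseI)
    fix x b assume *: "\<And>y. y \<in> ?D (Suc n) \<Longrightarrow> y \<le> x \<Longrightarrow> y \<le> b"
    show "x \<le> b"
    proof (rule join_denseD[OF Suc.IH])
      fix y assume "y \<in> ?D n" and yx: "y \<le> x"
      then obtain k where k: "\<And>s. length s < n \<Longrightarrow> y \<in> covered F i (s @ [k])" by blast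
      let ?S = "{s. set s \<subseteq> {..k} \<and> length s \<le> n}"
      have fin: "finite ?S" by (simp add: finite_lists_length_le)
      show "y \<le> b"
      proof (rule join_denseD[OF join_dense_INT[OF fin dense1 lower1]])
        fix z assume z: "z \<in> (\<Inter>s\<in>?S. \<Union>m. covered F i (s @ [m]))" and zy: "z \<le> y"
        then have "\<forall>s\<in>?S. \<exists>m. z \<in> covered F i (s @ [m])" by blast
        then obtain g where g: "\<And>s. s \<in> ?S \<Longrightarrow> z \<in> covered F i (s @ [g s])" by metis
        define m where "m = Max (g ` ?S)"
        have "z \<in> covered F i (s @ [m])" if "length s < Suc n" for s
        proof (cases "s \<in> ?S")
          case True
          then have "g s \<le> m" unfolding m_def using fin by (intro Max_ge) auto
          then show ?thesis by (rule covered_mono[OF mono _ g[OF True]])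
        next
          case False
          then have "y \<in> covered F i s"
            using covered_large_entry[OF mono k] that by auto
          then show ?thesis by (intro covered_extend covered_downward[OF _ zy])
        qed
        then have "z \<in> ?D (Suc n)" by (intro CollectI exI allI impI)
        then show "z \<le> b" using order_trans[OF zy yx] by (rule *)
      qed
    qed
  qed
qed

text \<open>
  After the choices recorded in \<open>s\<close>, the next cover is \<open>\<Union>m. F s m\<close>, and the choice of \<open>m\<close> keeps its
  part \<open>F s m\<close>. Finiteness of these parts is not needed, only that they increase with \<open>m\<close>. The
  sequence \<open>f\<close> found is such that the kept parts form a cover even after finitely many of them are
  dropped. For each threshold \<open>i\<close>, the selection principle is applied to the join-dense sets of
  the preceding lemma with \<open>n > i\<close>, which yields lower bounds on the entries of \<open>f\<close>; one \<open>f\<close> can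
  meet the bounds for all thresholds, as only finitely many of them concern a given entry.
\<close>

lemma finite_choices:
  fixes F :: "nat list \<Rightarrow> nat \<Rightarrow> 'a::bounded_lattice_top set"
  assumes C: "C_omega_1 TYPE('a)" and S1: "S1 (V1 :: 'a set set) V1"
    and nontrivial: "(z::'a) \<noteq> top"
    and mono: "\<And>s. mono (F s)" and cnt: "\<And>s m. countable (F s m)"
    and ne: "\<And>s m. F s m \<noteq> {}"
    and cover: "\<And>s. (\<Union>m. F s m) \<in> V1"
  obtains f :: "nat \<Rightarrow> nat" where "\<And>k. (\<Union>n\<in>{k..}. F (map f [0..<n]) (f n)) \<in> V1"
proof -
  let ?D = "\<lambda>i n. {y. \<exists>m. \<forall>s. length s < n \<longrightarrow> y \<in> covered F i (s @ [m])}"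
  have D: "?D i n \<in> V1" for i n
    using join_dense_imp_V1[OF join_dense_covered[OF C mono cnt cover] nontrivial] .
  have "\<exists>y. (\<forall>n. y n \<in> ?D i (Suc (i + n))) \<and> range y \<in> V1" for i
    by (rule S1[unfolded S1_def, rule_format]) (rule D)
  then have "\<exists>y. \<forall>i. (\<forall>n. y i n \<in> ?D i (Suc (i + n))) \<and> range (y i) \<in> V1"
    by (intro choice allI)
  then obtain y where y: "\<And>i n. y i n \<in> ?D i (Suc (i + n))" "\<And>i. range (y i) \<in> V1" by blast
  have "\<forall>i n. \<exists>m. \<forall>s. length s < Suc (i + n) \<longrightarrow> y i n \<in> covered F i (s @ [m])"
    using y(1) by blast
  then obtain g where g: "\<And>i n s. length s < Suc (i + n) \<Longrightarrow> y i n \<in> covered F i (s @ [g i n])"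
    by metis
  \<comment> \<open>The \<open>n\<close>-th choice dominates those required at time \<open>n\<close> for the thresholds \<open>i \<le> n\<close>.\<close>
  define f where "f n = (\<Sum>i\<le>n. g i (n - i))" for n
  have f: "g i n \<le> f (i + n)" for i n
    using member_le_sum[of i "{..i + n}" "\<lambda>j. g j (i + n - j)"] by (simp add: f_def)
  have "(\<Union>n\<in>{k..}. F (map f [0..<n]) (f n)) \<in> V1" for k
    unfolding V1_iff
  proof (intro conjI allI impI)
    show "(\<Union>n\<in>{k..}. F (map f [0..<n]) (f n)) \<noteq> {}" using ne by auto
    fix b assume b: "\<forall>a\<in>(\<Union>n\<in>{k..}. F (map f [0..<n]) (f n)). a \<le> b"
    \<comment> \<open>This threshold excludes the choices made before time \<open>k\<close>.\<close>
    define i where "i = Suc (\<Sum>j<k. f j)"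
    have i: "k \<le> j" if "i \<le> f j" for j
    proof (rule ccontr)
      assume "\<not> k \<le> j"
      then have "f j \<le> (\<Sum>j<k. f j)" by (intro member_le_sum) auto
      then show False using that by (simp add: i_def)
    qed
    have "y i n \<le> b" for n
    proof -
      let ?s = "map f [0..<i + n]"
      have "y i n \<in> covered F i (?s @ [f (i + n)])"
        using covered_mono[OF mono f g[of ?s]] by simp
      moreover have "?s @ [f (i + n)] = map f [0..<Suc (i + n)]" by simp
      ultimately have "y i n \<in> covered F i (map f [0..<Suc (i + n)])" by metis
      moreover have "u \<le> b" if "j < Suc (i + n)" "i \<le> f j"
        "u \<in> F (take j (map f [0..<Suc (i + n)])) (f j)" for j u
      proof -
        have "take j (map f [0..<Suc (i + n)]) = map f [0..<j]"
          using that(1) by (simp only: take_map take_upt) (simp add: take_upt)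
        then show ?thesis using b i[OF that(2)] that(3) by auto
      qed
      ultimately show ?thesis
        unfolding covered_def by (simp del: upt_Suc)
    qed
    then show "b = top" using y(2)[of i] unfolding V1_iff by blast
  qed
  then show ?thesis using that by blast
qed

section \<open>Defeating a strategy of Player I\<close>

lemma common_refinement:
  fixes \<kappa> :: "'h \<Rightarrow> 'a::bounded_lattice_top set"
  assumes C: "C_omega_1 TYPE('a)" and S1: "S1 (V1 :: 'a set set) V1"
    and nontrivial: "(z::'a) \<noteq> top"
    and "finite H" and \<kappa>: "\<And>h. h \<in> H \<Longrightarrow> countable (\<kappa> h) \<and> \<kappa> h \<in> V1"
  obtains e :: "nat \<Rightarrow> 'a" where "range e \<in> V1" "\<And>k h. h \<in> H \<Longrightarrow> \<exists>v\<in>\<kappa> h. e k \<le> v"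
proof -
  let ?Y = "\<lambda>h. {y. \<exists>v\<in>\<kappa> h. y \<le> v}"
  have "join_dense (\<Inter>h\<in>H. ?Y h)"
  proof (rule join_dense_INT[OF \<open>finite H\<close>])
    fix h assume "h \<in> H"
    then show "join_dense (?Y h)"
      using \<kappa> by (intro join_dense_if_below_cover[OF C, of "\<kappa> h"]) auto
    show "lower_set (?Y h)" unfolding lower_set_def by (auto intro: order_trans)
  qed
  then have "(\<Inter>h\<in>H. ?Y h) \<in> V1" using join_dense_imp_V1 nontrivial by blast
  then obtain e :: "nat \<Rightarrow> 'a" where "range e \<subseteq> (\<Inter>h\<in>H. ?Y h)" "range e \<in> V1"
    using countable_subcover[OF S1] by blast
  then show ?thesis using that by blast
qed

lemma II_defeats_strategy:
  assumes C: "C_omega_1 TYPE('a::bounded_lattice_top)" and S1: "S1 (V1 :: 'a set set) V1"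
    and nontrivial: "(z::'a) \<noteq> top"
    and \<sigma>: "\<And>h. \<sigma> h \<in> (V1 :: 'a set set)"
  obtains a where "\<And>n. a n \<in> \<sigma> (map a [0..<n])" "range a \<in> V1"
proof -
  have "\<forall>h. \<exists>e :: nat \<Rightarrow> 'a. range e \<subseteq> \<sigma> h \<and> range e \<in> V1"
    using countable_subcover[OF S1 \<sigma>] by blast
  then obtain e :: "'a list \<Rightarrow> nat \<Rightarrow> 'a"
    where e: "\<And>h. range (e h) \<subseteq> \<sigma> h" "\<And>h. range (e h) \<in> V1" by metis
  have "\<forall>H. \<exists>r :: nat \<Rightarrow> 'a. finite H \<longrightarrow>
      range r \<in> V1 \<and> (\<forall>k. \<forall>h\<in>H. \<exists>v\<in>range (e h). r k \<le> v)"
    using common_refinement[OF C S1 nontrivial, where \<kappa> = "\<lambda>h. range (e h)"] e(2)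
    by (metis countableI_type countable_image)
  then obtain r :: "'a list set \<Rightarrow> nat \<Rightarrow> 'a" where r: "\<And>H. finite H \<Longrightarrow> range (r H) \<in> V1"
    "\<And>H k h. finite H \<Longrightarrow> h \<in> H \<Longrightarrow> \<exists>v\<in>range (e h). r H k \<le> v" by metis
  \<comment> \<open>The answer of Player II in the history \<open>h\<close> to the choice of the element \<open>u\<close> of a refinement.\<close>
  define v where "v h u = (SOME v. v \<in> range (e h) \<and> u \<le> v)" for h u
  have v: "v h (r H k) \<in> range (e h)" "r H k \<le> v h (r H k)" if "finite H" "h \<in> H" for h H k
  proof -
    have "\<exists>v. v \<in> range (e h) \<and> r H k \<le> v" using r(2)[OF that] by blast
    then show "v h (r H k) \<in> range (e h)" "r H k \<le> v h (r H k)"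
      unfolding v_def by (metis (mono_tags, lifting) someI_ex)+
  qed
  \<comment> \<open>The histories kept after choosing, again and again, an initial segment of the refinement.\<close>
  define step where "step H m = {h @ [v h u] | h u. h \<in> H \<and> u \<in> r H ` {..m}}" for H and m :: nat
  define hist where "hist s = foldl step {[]} s" for s
  have hist_snoc: "hist (s @ [m]) = step (hist s) m" for s m
    by (simp add: hist_def)
  have fin: "finite (hist s)" for s
  proof (induction s rule: rev_induct)
    case (snoc m s)
    have "step (hist s) m = (\<lambda>(h, u). h @ [v h u]) ` (hist s \<times> r (hist s) ` {..m})"
      unfolding step_def by auto
    then show ?case using snoc by (simp add: hist_snoc)
  qed (simp add: hist_def)
  define F where "F s m = r (hist s) ` {..m}" for s and m :: nat
  have mono: "mono (F s)" for s
    unfolding F_def by (intro monoI image_mono) simp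
  have cover: "(\<Union>m. F s m) \<in> V1" for s
  proof -
    have "(\<Union>m. F s m) = range (r (hist s))" unfolding F_def by auto
    then show ?thesis using r(1) fin by simp
  qed
  obtain f where f: "\<And>k. (\<Union>n\<in>{k..}. F (map f [0..<n]) (f n)) \<in> V1"
    using finite_choices[OF C S1 nontrivial, where F = F] mono cover by (auto simp: F_def)
  obtain u where u: "\<And>n. u n \<in> F (map f [0..<n]) (f n)" "range u \<in> V1"
    using one_from_each[OF C S1 nontrivial _ _ f] by (auto simp: F_def)
  define h where "h = rec_nat [] (\<lambda>n h. h @ [v h (u n)])"
  have h_simps: "h 0 = []" "h (Suc n) = h n @ [v (h n) (u n)]" for n
    by (simp_all add: h_def)
  define a where "a n = v (h n) (u n)" for n
  have h: "h n = map a [0..<n]" for n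
    by (induction n) (simp_all add: h_simps a_def)
  have hist: "h n \<in> hist (map f [0..<n])" for n
  proof (induction n)
    case 0
    then show ?case by (simp add: h_simps hist_def)
  next
    case (Suc n)
    then show ?case using u(1)[of n] by (auto simp: h_simps hist_snoc step_def F_def)
  qed
  have a: "a n \<in> range (e (h n))" "u n \<le> a n" for n
    using v[OF fin hist[of n]] u(1)[of n] by (auto simp: a_def F_def)
  show ?thesis
  proof (rule that)
    show "a n \<in> \<sigma> (map a [0..<n])" for n
      using a(1)[of n] e(1)[of "h n"] by (auto simp: h)
    show "range a \<in> V1"
      unfolding V1_iff
    proof (intro conjI allI impI)
      fix b assume "\<forall>x\<in>range a. x \<le> b"
      then have "\<forall>x\<in>range u. x \<le> b" using a(2) by (blast intro: order_trans)
      then show "b = top" using u(2) unfolding V1_iff by blast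
    qed simp
  qed
qed

theorem theorem4p5:
  assumes "C_omega_1 TYPE('a::bounded_lattice_top)"
  shows "S1 (V1 :: 'a set set) V1 \<longleftrightarrow>
    \<not> (\<exists>\<sigma>. G1_I_winning_strategy (V1 :: 'a set set) V1 \<sigma>)"
proof
  assume S1: "S1 (V1 :: 'a set set) V1"
  have "\<not> G1_I_winning_strategy V1 V1 \<sigma>" for \<sigma> :: "'a list \<Rightarrow> 'a set"
  proof
    assume win: "G1_I_winning_strategy V1 V1 \<sigma>"
    then have \<sigma>: "\<sigma> h \<in> V1" for h
      by (simp add: G1_I_winning_strategy_def G1_I_strategy_def)
    have "\<exists>a. (\<forall>n. a n \<in> \<sigma> (map a [0..<n])) \<and> range a \<in> V1"
    proof (cases "\<exists>z::'a. z \<noteq> top")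
      case True
      then obtain z :: 'a where z: "z \<noteq> top" by blast
      show ?thesis by (rule II_defeats_strategy[OF assms S1 z, of \<sigma>]) (use \<sigma> in blast)+
    next
      case False
      then have all_top: "x = top" for x :: 'a by blast
      have "top \<in> \<sigma> h" for h
        using \<sigma>[of h] all_top unfolding V1_iff by (metis all_not_in_conv)
      moreover have "range (\<lambda>n::nat. top) \<in> (V1 :: 'a set set)"
        using all_top by (simp add: V1_iff top_unique)
      ultimately show ?thesis by (intro exI[of _ "\<lambda>_. top"]) simp
    qed
    then obtain a where a: "\<And>n. a n \<in> \<sigma> (map a [0..<n])" "range a \<in> V1" by blast
    have "G1_play V1 (\<lambda>n. \<sigma> (map a [0..<n])) a"
      using a(1) \<sigma> by (simp add: G1_play_def)
    then have "\<not> G1_II_wins V1 a"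
      using win unfolding G1_I_winning_strategy_def by blast
    then show False
      using a(2) by (simp add: G1_II_wins_def)
  qed
  then show "\<not> (\<exists>\<sigma>. G1_I_winning_strategy (V1 :: 'a set set) V1 \<sigma>)" by blast
next
  assume no_win: "\<not> (\<exists>\<sigma>. G1_I_winning_strategy (V1 :: 'a set set) V1 \<sigma>)"
  show "S1 (V1 :: 'a set set) V1"
  proof (rule ccontr)
    assume "\<not> S1 (V1 :: 'a set set) V1"
    then obtain A :: "nat \<Rightarrow> 'a set" where A: "\<forall>n. A n \<in> V1"
      "\<not> (\<exists>a. (\<forall>n. a n \<in> A n) \<and> range a \<in> V1)"
      unfolding S1_def by blast
    have "G1_I_winning_strategy V1 V1 (\<lambda>h. A (length h))"
      unfolding G1_I_winning_strategy_def G1_I_strategy_def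
    proof (intro conjI allI impI)
      show "A (length h) \<in> V1" for h :: "'a list"
        using A(1) by blast
      fix B and a :: "nat \<Rightarrow> 'a"
      assume "G1_play V1 B a \<and> (\<forall>n. B n = A (length (map a [0..<n])))"
      then have "\<forall>n. a n \<in> A n" by (auto simp: G1_play_def)
      then show "\<not> G1_II_wins V1 a" using A(2) by (auto simp: G1_II_wins_def)
    qed
    then show False using no_win by blast
  qed
qed

end
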